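(* For any integers $b\ge2$, $\lambda\ge1$, and any real number $\kappa>0$ we have $$\int_0^1\prod_{j=0}^{\lambda-1}\bigl|K_b\bigl(\alpha b^{j+1}+\alpha b^{2\lambda+1-j}\bigr)\bigr|^{2\kappa}\,d\alpha\ \le\ \Bigl(\max_{\alpha\in\mathbb R}T_{b,\frac\kappa2}(\alpha)\Bigr)^{2\lambda-2}=b^{-\zeta_{b,\frac\kappa2}(2\lambda-2)}\ \le\ \Bigl(\frac1b+\sqrt{\frac{12(b+1)}{\pi(b-1)\,\kappa}}\Bigr)^{2\lambda-2}.$$
   Context: $K_b(x)=\frac{\sin(\pi b x)}{b\sin(\pi x)}$ for $x\in\mathbb R\setminus\mathbb Z$ and $K_b(n)=(-1)^{n(b-1)}$ for $n\in\mathbb Z$. $\|x\|=\min_{k\in\mathbb Z}|x-k|$. For real $\kappa>0$, $$T_{b,\kappa}(\alpha)=\frac1b\sum_{\ell=0}^{b-1}K_b^{\kappa}\Bigl(\frac1{b+1}\Bigl\|\frac{\alpha+\ell}{b}\Bigr\|\Bigr),\qquad \zeta_{b,\kappa}=\frac{-\log\bigl(\max_{\alpha\in\mathbb R}T_{b,\kappa}(\alpha)\bigr)}{\log b}.$$ *)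

theory Defs
  imports "HOL-Analysis.Analysis"
begin

definition K :: "nat \<Rightarrow> real \<Rightarrow> real" where
  "K b x = (if x \<in> \<int> then (-1) powi (\<lfloor>x\<rfloor> * (int b - 1))
            else sin (pi * real b * x) / (real b * sin (pi * x)))"

text \<open>The infimum over all integers \<open>k\<close> is a minimum, see \<open>dist_int_attained\<close>.\<close>

definition dist_int :: "real \<Rightarrow> real" where
  "dist_int x = (INF k::int. \<bar>x - of_int k\<bar>)"

text \<open>The argument of \<open>K b\<close> below lies in \<open>[0, 1 / (2 * (b + 1))]\<close>, where \<open>K b\<close> is positive,
  so \<open>powr\<close> is the real power.\<close>

definition T :: "nat \<Rightarrow> real \<Rightarrow> real \<Rightarrow> real" where
  "T b \<kappa> \<alpha> = 1 / real b * (\<Sum>l<b. K b (1 / (real b + 1) * dist_int ((\<alpha> + real l) / real b)) powr \<kappa>)"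

text \<open>The supremum over all real \<open>\<alpha>\<close> is a maximum, see \<open>T_attains_max\<close>.\<close>

definition max_T :: "nat \<Rightarrow> real \<Rightarrow> real" where
  "max_T b \<kappa> = (SUP \<alpha>::real. T b \<kappa> \<alpha>)"

definition zeta :: "nat \<Rightarrow> real \<Rightarrow> real" where
  "zeta b \<kappa> = - ln (max_T b \<kappa>) / ln (real b)"

lemma dist_int_attained: "dist_int x = \<bar>x - of_int (round x)\<bar>"
proof -
  have "\<bar>x - of_int (round x)\<bar> \<le> \<bar>x - of_int k\<bar>" for k :: int
    using round_diff_minimal[of x k] by (simp add: abs_minus_commute)
  then show ?thesis
    unfolding dist_int_def by (intro cInf_eq_minimum) auto
qed

lemma dist_int_bounds: "0 \<le> dist_int x" "dist_int x \<le> 1 / 2"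
  using of_int_round_abs_le[of x] by (auto simp: dist_int_attained abs_minus_commute)

lemma dist_int_add_int: "dist_int (x + of_int m) = dist_int x"
  by (simp add: dist_int_attained round_def add.commute[of _ "1/2"] flip: add.assoc)

lemma dist_int_le: "dist_int x \<le> \<bar>x - of_int k\<bar>"
  using round_diff_minimal[of x k] by (simp add: dist_int_attained abs_minus_commute)

lemma continuous_on_dist_int: "continuous_on S dist_int"
proof -
  have "dist_int x \<le> dist_int y + \<bar>x - y\<bar>" for x y
    using dist_int_le[of x "round y"] dist_int_attained[of y] by linarith
  then have "\<bar>dist_int x - dist_int y\<bar> \<le> \<bar>x - y\<bar>" for x y
    by (smt (verit))
  then have "1-lipschitz_on S dist_int"
    by (intro lipschitz_onI) (auto simp: dist_real_def)
  then show ?thesis by (rule lipschitz_on_continuous_on)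
qed

lemma K_eq_cos_sum:
  assumes "b \<ge> 1"
  shows "K b x = (\<Sum>k<b. cos ((real b - 1 - 2 * real k) * (pi * x))) / b"
proof (cases "x \<in> \<int>")
  case True
  then obtain n where n: "x = of_int n" by (auto elim: Ints_cases)
  have "cos ((real b - 1 - 2 * real k) * (pi * x)) = (-1) powi (n * (int b - 1))" for k
  proof -
    have "(real b - 1 - 2 * real k) * (pi * x) = pi * of_int (n * (int b - 1 - 2 * int k))"
      by (simp add: n algebra_simps)
    then have "cos ((real b - 1 - 2 * real k) * (pi * x)) = (if even (n * (int b - 1 - 2 * int k)) then 1 else -1)"
      by (simp only: cos_npi_int)
    also have "even (n * (int b - 1 - 2 * int k)) \<longleftrightarrow> even (n * (int b - 1))" by simp
    finally show ?thesis by (simp add: power_int_minus_left)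
  qed
  then show ?thesis using assms True by (simp add: K_def n)
next
  case False
  have s: "sin (pi * x) \<noteq> 0"
    using False by (auto simp: sin_zero_iff_int2)
  define f where "f k = sin ((real b - 2 * real k) * (pi * x)) / 2" for k
  have "sin (pi * x) * cos ((real b - 1 - 2 * real k) * (pi * x)) = f k - f (Suc k)" for k
  proof -
    define c where "c = (real b - 1 - 2 * real k) * (pi * x)"
    have "(real b - 2 * real k) * (pi * x) = c + pi * x"
      "(real b - 2 * real (Suc k)) * (pi * x) = c - pi * x"
      by (simp_all add: c_def algebra_simps)
    then show ?thesis
      unfolding f_def c_def[symmetric] by (simp add: sin_add sin_diff field_simps)
  qed
  then have "sin (pi * x) * (\<Sum>k<b. cos ((real b - 1 - 2 * real k) * (pi * x)))
      = (\<Sum>k<b. f k - f (Suc k))"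
    by (simp add: sum_distrib_left)
  also have "\<dots> = f 0 - f b" by (rule sum_lessThan_telescope')
  also have "\<dots> = sin (pi * b * x)"
    by (simp add: f_def mult_ac)
  finally show ?thesis using False s assms by (simp add: K_def field_simps)
qed

lemma continuous_on_K: "b \<ge> 1 \<Longrightarrow> continuous_on S (K b)"
  by (subst continuous_on_cong[OF refl K_eq_cos_sum]) (auto intro!: continuous_intros)

lemma K_pos:
  assumes "b \<ge> 1" "0 \<le> x" "x \<le> 1 / (2 * (real b + 1))"
  shows "K b x > 0"
proof (cases "x = 0")
  case False
  then have x: "0 < x" using assms by simp
  have bx: "b * x < 1 / 2"
  proof -
    have "b * x \<le> b * (1 / (2 * (real b + 1)))" using assms by (intro mult_left_mono) auto
    also have "\<dots> < 1 / 2" by (simp add: field_simps)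
    finally show ?thesis .
  qed
  have "x \<le> b * x" using assms(1) x by simp
  then have x1: "x < 1" using bx by linarith
  have "x \<notin> \<int>" using x x1 by (auto elim!: Ints_cases)
  moreover have "sin (pi * (b * x)) > 0"
    using x assms(1) bx by (intro sin_gt_zero) auto
  moreover have "sin (pi * x) > 0" using x x1 by (intro sin_gt_zero) auto
  ultimately show ?thesis using assms(1) by (simp add: K_def mult.assoc)
qed (simp add: K_def)

lemma K_arg_pos: "b \<ge> 1 \<Longrightarrow> K b (1 / (real b + 1) * dist_int y) > 0"
proof -
  assume b: "b \<ge> 1"
  have "1 / (real b + 1) * dist_int y \<le> 1 / (real b + 1) * (1 / 2)"
    by (intro mult_left_mono dist_int_bounds) auto
  then show ?thesis
    using b dist_int_bounds(1)[of y] by (intro K_pos) (auto simp: field_simps)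
qed

lemma T_attains_max:
  assumes "b \<ge> 1"
  shows "\<exists>\<alpha>. T b \<kappa> \<alpha> = max_T b \<kappa> \<and> (\<forall>\<beta>. T b \<kappa> \<beta> \<le> T b \<kappa> \<alpha>)"
proof -
  have cont: "continuous_on {0..real b} (T b \<kappa>)"
  proof -
    have "continuous_on {0..real b}
      (\<lambda>x. K b (1 / (real b + 1) * dist_int ((x + real l) / real b)) powr \<kappa>)" for l
    proof (rule continuous_on_powr)
      show "continuous_on {0..real b} (\<lambda>x. K b (1 / (real b + 1) * dist_int ((x + real l) / real b)))"
        by (intro continuous_on_compose2[OF continuous_on_K[OF assms, of UNIV]] continuous_intros
            continuous_on_compose2[OF continuous_on_dist_int[of UNIV]]) (use assms in auto)
      show "\<forall>x\<in>{0..real b}. K b (1 / (real b + 1) * dist_int ((x + real l) / real b)) \<noteq> 0"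
        using K_arg_pos[OF assms] by (metis less_irrefl)
    qed auto
    then show ?thesis
      unfolding T_def by (intro continuous_on_mult_left continuous_on_sum)
  qed
  obtain \<alpha> where \<alpha>: "\<alpha> \<in> {0..real b}" "\<And>\<beta>. \<beta> \<in> {0..real b} \<Longrightarrow> T b \<kappa> \<beta> \<le> T b \<kappa> \<alpha>"
    using continuous_attains_sup[OF compact_Icc _ cont] assms by auto
  have "T b \<kappa> \<beta> \<le> T b \<kappa> \<alpha>" for \<beta>
  proof -
    define m where "m = \<lfloor>\<beta> / b\<rfloor>"
    define \<gamma> where "\<gamma> = \<beta> - b * of_int m"
    have "of_int m \<le> \<beta> / b" "\<beta> / b < of_int m + 1" by (simp_all add: m_def)
    then have "\<gamma> \<in> {0..real b}" using assms by (simp add: \<gamma>_def field_simps)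
    moreover have "(\<beta> + real l) / b = (\<gamma> + real l) / b + of_int m" for l
      using assms by (simp add: \<gamma>_def field_simps)
    then have "T b \<kappa> \<beta> = T b \<kappa> \<gamma>" by (simp add: T_def dist_int_add_int)
    ultimately show ?thesis using \<alpha>(2) by simp
  qed
  moreover from this have "max_T b \<kappa> = T b \<kappa> \<alpha>"
    unfolding max_T_def by (intro cSup_eq_maximum) auto
  ultimately show ?thesis by metis
qed

lemma K_prod_integrable:
  assumes "b \<ge> 1" "\<kappa> > 0"
  shows "(\<lambda>\<alpha>. \<Prod>j<n. \<bar>K b (\<alpha> * real b ^ (j + 1) + \<alpha> * real b ^ (2 * n + 1 - j))\<bar> powr (2 * \<kappa>))
    integrable_on {0..1}"
  by (intro integrable_continuous_real continuous_on_prod continuous_on_powr' continuous_intros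
      continuous_on_compose2[OF continuous_on_K[OF assms(1), of UNIV]]) (use assms in auto)

end

theory Submission
  imports Defs "HOL-Probability.Distributions"
begin

text \<open>
  The kernel \<open>K b\<close> is large in absolute value only close to the integers, and the arguments of two
  consecutive factors of the product cannot in general both be close to integers: writing \<open>y j\<close> for
  the argument of the \<open>j\<close>-th factor, \<open>b * y j - y (j + 1)\<close> and \<open>b * y (j + 1) - y j\<close> are
  \<open>(b\<^sup>2 - 1) * \<alpha>\<close> times a single power of \<open>b\<close>. By \<open>abs_K_mult_le\<close> the product of two consecutive
  kernel values is at most the kernel at \<open>1 / (b + 1)\<close> times the distance of either of these numbers
  from the integers. The integrand is split into \<open>n - 1\<close> such pairs, each with exponent \<open>\<kappa>\<close>, and
  for each pair the geometric mean of the two bounds is taken. This gives \<open>2 * n - 2\<close> factors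
  \<open>T_term b (\<kappa> / 2) (b ^ m * (b\<^sup>2 - 1) * \<alpha>)\<close> with distinct exponents \<open>m\<close>
  (\<open>K_prod_le_T_term_prod\<close>).

  The integral of such a product is estimated one base-\<open>b\<close> digit of the variable at a time: the
  average of \<open>T_term b \<kappa>\<close> over a digit is a value of \<open>T b \<kappa>\<close>, hence at most \<open>max_T b \<kappa>\<close>
  (\<open>integral_prod_dilates_le\<close>, \<open>integral_T_term_prod_le\<close>).

  The equality with a power of \<open>b\<close> is the definition of \<open>zeta\<close>. For the explicit bound, \<open>K b\<close> lies
  below a Gaussian on its main lobe (\<open>K_le_gaussian\<close>), because \<open>sin v / v * exp (v\<^sup>2 / 6)\<close> decreases
  on \<open>(0, pi]\<close>. Then \<open>T b \<kappa>\<close> is at most a Riemann sum of a Gaussian with mesh \<open>1 / b\<close>, which exceeds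
  the Gaussian integral by at most the mesh times the peak height (\<open>gaussian_sum_le\<close>, \<open>T_le\<close>).
\<close>

section \<open>The peak of the kernel dominates its side lobes\<close>

lemma cos_antimono_abs:
  fixes u v :: real
  assumes "\<bar>u\<bar> \<le> \<bar>v\<bar>" "\<bar>v\<bar> \<le> pi"
  shows "cos v \<le> cos u"
  using cos_mono_le_eq[of "\<bar>v\<bar>" "\<bar>u\<bar>"] assms by simp

lemma abs_K_le_1:
  assumes "b \<ge> 1"
  shows "\<bar>K b x\<bar> \<le> 1"
proof -
  have "\<bar>\<Sum>k<b. cos ((real b - 1 - 2 * real k) * (pi * x))\<bar>
      \<le> (\<Sum>k<b. \<bar>cos ((real b - 1 - 2 * real k) * (pi * x))\<bar>)"
    by (rule sum_abs)
  also have "\<dots> \<le> (\<Sum>k<b. 1)" by (intro sum_mono) simp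
  finally show ?thesis using assms by (simp add: K_eq_cos_sum)
qed

text \<open>In the expansion of \<open>K b\<close> into cosines every frequency is at most \<open>b * pi\<close> in absolute value,
  so up to \<open>1 / b\<close> no cosine leaves the half-period on which it decreases.\<close>

lemma K_antimono:
  assumes "b \<ge> 1" "0 \<le> s" "s \<le> t" "t \<le> 1 / real b"
  shows "K b t \<le> K b s"
proof -
  have "cos ((real b - 1 - 2 * real k) * (pi * t)) \<le> cos ((real b - 1 - 2 * real k) * (pi * s))"
    if "k < b" for k
  proof (rule cos_antimono_abs)
    show "\<bar>(real b - 1 - 2 * real k) * (pi * s)\<bar> \<le> \<bar>(real b - 1 - 2 * real k) * (pi * t)\<bar>"
      using assms by (simp add: abs_mult mult_left_mono)
    have "\<bar>real b - 1 - 2 * real k\<bar> \<le> real b" using that by linarith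
    then have "\<bar>real b - 1 - 2 * real k\<bar> * (pi * t) \<le> real b * (pi * (1 / real b))"
      using assms by (intro mult_mono) auto
    then show "\<bar>(real b - 1 - 2 * real k) * (pi * t)\<bar> \<le> pi"
      using assms by (simp add: abs_mult)
  qed
  then have "(\<Sum>k<b. cos ((real b - 1 - 2 * real k) * (pi * t)))
      \<le> (\<Sum>k<b. cos ((real b - 1 - 2 * real k) * (pi * s)))"
    by (intro sum_mono) auto
  then show ?thesis using assms(1) by (simp add: K_eq_cos_sum divide_right_mono)
qed

lemma K_nonneg:
  assumes b: "b \<ge> 1" and t: "0 \<le> t" "t \<le> 1 / (2 * real b)"
  shows "0 \<le> K b t"
proof -
  have "0 \<le> cos ((real b - 1 - 2 * real k) * (pi * t))" if "k < b" for k
  proof (rule cos_ge_zero)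
    have "\<bar>real b - 1 - 2 * real k\<bar> \<le> real b" using that by linarith
    then have "\<bar>real b - 1 - 2 * real k\<bar> * (pi * t) \<le> real b * (pi * (1 / (2 * real b)))"
      using t by (intro mult_mono) auto
    then have "\<bar>(real b - 1 - 2 * real k) * (pi * t)\<bar> \<le> pi / 2"
      using b t by (simp add: abs_mult)
    then show "- (pi / 2) \<le> (real b - 1 - 2 * real k) * (pi * t)"
      "(real b - 1 - 2 * real k) * (pi * t) \<le> pi / 2" by linarith+
  qed
  then show ?thesis
    unfolding K_eq_cos_sum[OF b] by (intro divide_nonneg_nonneg sum_nonneg) simp_all
qed

lemma K_minus: "b \<ge> 1 \<Longrightarrow> K b (- x) = K b x"
  by (simp add: K_eq_cos_sum)

lemma abs_K_add_int:
  assumes "b \<ge> 1"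
  shows "\<bar>K b (x + of_int m)\<bar> = \<bar>K b x\<bar>"
proof (cases "x \<in> \<int>")
  case True
  then have "x + of_int m \<in> \<int>" by simp
  with True show ?thesis by (simp add: K_def power_int_minus_left)
next
  case False
  then have "x + of_int m \<notin> \<int>"
    by (metis Ints_diff Ints_of_int add_diff_cancel_right')
  moreover have s: "\<bar>sin (y + pi * of_int k)\<bar> = \<bar>sin y\<bar>" for y k
    by (simp add: sin_add sin_npi_int cos_npi_int)
  have "\<bar>sin (pi * (x + of_int m))\<bar> = \<bar>sin (pi * x)\<bar>"
    using s[of "pi * x" m] by (simp add: algebra_simps)
  moreover have "\<bar>sin (pi * real b * (x + of_int m))\<bar> = \<bar>sin (pi * real b * x)\<bar>"
    using s[of "pi * real b * x" "int b * m"] by (simp add: algebra_simps)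
  ultimately show ?thesis using False by (simp add: K_def abs_mult)
qed

lemma abs_K_dist_int:
  assumes "b \<ge> 1"
  shows "\<bar>K b (dist_int x)\<bar> = \<bar>K b x\<bar>"
proof -
  have "\<bar>K b (x - of_int (round x))\<bar> = \<bar>K b x\<bar>"
    using abs_K_add_int[OF assms, of x "- round x"] by simp
  then show ?thesis
    using K_minus[OF assms, of "x - of_int (round x)"] by (auto simp: dist_int_attained abs_if[of "x - _"])
qed

text \<open>The peak of \<open>K b\<close> at the integers dominates its side lobes. Close to an integer this is
  monotonicity; beyond distance \<open>1 / (2 * b)\<close> the numerator of \<open>K b\<close> is at most 1, while the
  denominator exceeds its value at \<open>1 / (2 * b)\<close>, a point where the numerator equals 1.\<close>

lemma abs_K_le_K:
  assumes b: "b \<ge> 1" and t: "0 \<le> t" "t \<le> 1 / (2 * real b)" "t \<le> dist_int x"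
  shows "\<bar>K b x\<bar> \<le> K b t"
proof -
  define d where "d = dist_int x"
  have d: "0 \<le> d" "d \<le> 1 / 2" using dist_int_bounds by (simp_all add: d_def)
  have half: "1 / (2 * real b) \<le> 1 / real b" using b by (simp add: field_simps)
  have "\<bar>K b d\<bar> \<le> K b t"
  proof (cases "d \<le> 1 / (2 * real b)")
    case True
    have "0 \<le> K b d" using d True by (intro K_nonneg[OF b]) auto
    moreover have "K b d \<le> K b t"
      using b t True half by (intro K_antimono) (auto simp: d_def)
    ultimately show ?thesis by linarith
  next
    case False
    then have dgt: "d > 1 / (2 * real b)" by simp
    have pos: "0 < 1 / (2 * real b)" using b by simp
    have nI: "y \<notin> \<int>" if "0 < y" "y \<le> 1 / 2" for y :: real
      using that by (auto elim!: Ints_cases)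
    have q: "1 / (2 * real b) \<le> 1 / 2" using b by (simp add: field_simps)
    have sle: "sin (pi * (1 / (2 * real b))) \<le> sin (pi * d)"
    proof (rule sin_monotone_2pi_le)
      show "- (pi / 2) \<le> pi * (1 / (2 * real b))" by (rule order_trans[of _ 0]) auto
      show "pi * (1 / (2 * real b)) \<le> pi * d" using dgt by (intro mult_left_mono) auto
      show "pi * d \<le> pi / 2" using d by simp
    qed
    have spos: "0 < sin (pi * (1 / (2 * real b)))"
      using pos q pi_gt_zero by (intro sin_gt_zero) (auto simp: field_simps intro: less_le_trans)
    have "\<bar>K b d\<bar> = \<bar>sin (pi * real b * d)\<bar> / (real b * sin (pi * d))"
      using nI[of d] dgt pos d sle spos by (simp add: K_def abs_mult)
    also have "\<dots> \<le> 1 / (real b * sin (pi * (1 / (2 * real b))))"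
      using sle spos b by (intro frac_le) auto
    also have "\<dots> = K b (1 / (2 * real b))"
      using nI[OF pos q] b by (simp add: K_def)
    also have "\<dots> \<le> K b t" using b t half by (intro K_antimono) auto
    finally show ?thesis .
  qed
  then show ?thesis using abs_K_dist_int[OF b, of x] by (simp add: d_def)
qed

section \<open>A product of two kernel values\<close>

lemma dist_int_dilate_diff_le:
  "dist_int (real b * x - y) \<le> real b * dist_int x + dist_int y"
proof -
  have "dist_int (real b * x - y) \<le> \<bar>real b * x - y - of_int (int b * round x - round y)\<bar>"
    by (rule dist_int_le)
  also have "\<dots> = \<bar>real b * (x - of_int (round x)) - (y - of_int (round y))\<bar>"
    by (simp add: algebra_simps)
  also have "\<dots> \<le> \<bar>real b * (x - of_int (round x))\<bar> + \<bar>y - of_int (round y)\<bar>"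
    by (rule abs_triangle_ineq4)
  finally show ?thesis by (simp add: dist_int_attained abs_mult)
qed

lemma scaled_dist_int_bounds:
  assumes "b \<ge> 1"
  shows "0 \<le> 1 / (real b + 1) * dist_int x" "1 / (real b + 1) * dist_int x \<le> 1 / (2 * real b)"
proof -
  show "0 \<le> 1 / (real b + 1) * dist_int x" using dist_int_bounds by simp
  have "1 / (real b + 1) * dist_int x \<le> 1 / (real b + 1) * (1 / 2)"
    by (intro mult_left_mono dist_int_bounds) auto
  also have "\<dots> \<le> 1 / (2 * real b)" using assms by (simp add: field_simps)
  finally show "1 / (real b + 1) * dist_int x \<le> 1 / (2 * real b)" .
qed

text \<open>If \<open>x\<close> and \<open>y\<close> are both closer than \<open>t\<close> to an integer, then \<open>b * x - y\<close> is closer than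
  \<open>(b + 1) * t\<close>. Hence one of the two factors is evaluated at distance at least
  \<open>dist_int (b * x - y) / (b + 1)\<close> from the integers, and the other one is bounded by 1.\<close>

lemma abs_K_mult_le:
  assumes b: "b \<ge> 1"
  shows "\<bar>K b x\<bar> * \<bar>K b y\<bar> \<le> K b (1 / (real b + 1) * dist_int (real b * x - y))"
proof -
  define t where "t = 1 / (real b + 1) * dist_int (real b * x - y)"
  have t0: "0 \<le> t" and t1: "t \<le> 1 / (2 * real b)"
    unfolding t_def by (rule scaled_dist_int_bounds[OF b])+
  have "(real b + 1) * t \<le> real b * dist_int x + dist_int y"
    using dist_int_dilate_diff_le[of b x y] by (simp add: t_def)
  then have "t \<le> dist_int x \<or> t \<le> dist_int y"
  proof -
    have "real b * dist_int x + dist_int y < (real b + 1) * t" if "dist_int x < t" "dist_int y < t"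
      using that mult_left_mono[of "dist_int x" t "real b"] by (simp add: distrib_right)
    then show ?thesis using \<open>(real b + 1) * t \<le> _\<close> by linarith
  qed
  then show ?thesis
  proof
    assume "t \<le> dist_int x"
    then have "\<bar>K b x\<bar> * \<bar>K b y\<bar> \<le> K b t * 1"
      by (intro mult_mono' abs_K_le_K[OF b t0 t1] abs_K_le_1[OF b] abs_ge_zero)
    then show ?thesis by (simp add: t_def)
  next
    assume "t \<le> dist_int y"
    then have "\<bar>K b x\<bar> * \<bar>K b y\<bar> \<le> 1 * K b t"
      by (intro mult_mono' abs_K_le_K[OF b t0 t1] abs_K_le_1[OF b] abs_ge_zero)
    then show ?thesis by (simp add: t_def)
  qed
qed

section \<open>Integrals of products of dilates\<close>

text \<open>Cut \<open>[0, 1]\<close> into \<open>m\<close> equal pieces and stretch each of them to unit length.\<close>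

lemma integral_average:
  fixes F :: "real \<Rightarrow> real"
  assumes F: "continuous_on UNIV F" and m: "m \<ge> 1"
  shows "integral {0..1} F = integral {0..1} (\<lambda>x. (\<Sum>l<m. F ((x + real l) / real m)) / real m)"
proof -
  define G where "G x = F (x / real m)" for x
  have G: "continuous_on S G" for S
    unfolding G_def by (intro continuous_on_compose2[OF F] continuous_intros) (use m in auto)
  have Gi: "G integrable_on {a..c}" for a c by (intro integrable_continuous_real G)
  have shift: "((\<lambda>x. G (x + a)) has_integral integral {a..a+1} G) {0..1}" for a
    using has_integral_affinity'[of G "integral {a..a+1} G" a "a + 1" 1 a] Gi[of a "a+1"]
    by (simp add: has_integral_integrable_integral)
  have "integral {0..real k} G = (\<Sum>l<k. integral {0..1} (\<lambda>x. G (x + real l)))" for k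
  proof (induction k)
    case (Suc k)
    have "integral {0..real k} G + integral {real k..real k + 1} G = integral {0..real k + 1} G"
      by (intro Henstock_Kurzweil_Integration.integral_combine Gi) auto
    then show ?case using Suc integral_unique[OF shift[of "real k"]] by (simp add: add.commute)
  qed simp
  also have "(\<Sum>l<m. integral {0..1} (\<lambda>x. G (x + real l))) = integral {0..1} (\<lambda>x. \<Sum>l<m. G (x + real l))"
    using shift by (intro integral_sum[symmetric]) (auto simp: integrable_on_def)
  finally have "integral {0..real m} G = \<dots>" .
  moreover have "(F has_integral (1 / real m) * integral {0..real m} G) {0..1}"
  proof -
    have "(\<lambda>x. G (real m * x)) = F" using m by (simp add: G_def)
    then show ?thesis
      using has_integral_affinity'[of G "integral {0..real m} G" 0 "real m" "real m" 0] m
        integrable_integral[OF Gi[of 0 "real m"]]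
      by (simp add: divide_inverse)
  qed
  ultimately show ?thesis
    by (simp add: integral_unique G_def)
qed


lemma periodic_add_nat:
  fixes h :: "real \<Rightarrow> 'a"
  assumes "\<And>x. h (x + 1) = h x"
  shows "h (x + real l) = h x"
proof (induction l)
  case (Suc l)
  then show ?case using assms[of "x + real l"] by (simp add: add_ac)
qed simp

lemma integral_periodic_dilate:
  fixes h :: "real \<Rightarrow> real"
  assumes h: "continuous_on UNIV h" "\<And>x. h (x + 1) = h x" and m: "m \<ge> 1"
  shows "integral {0..1} (\<lambda>x. h (real m * x)) = integral {0..1} h"
proof -
  have "continuous_on UNIV (\<lambda>x. h (real m * x))"
    by (intro continuous_on_compose2[OF h(1)] continuous_intros) auto
  from integral_average[OF this m] show ?thesis
    using m by (simp add: periodic_add_nat[of h, OF h(2)])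
qed

text \<open>Averaging over the \<open>b\<close> preimages of a point under \<open>x \<mapsto> b * x\<close> integrates out the lowest
  base-\<open>b\<close> digit. Only the factor with \<open>m = 0\<close> depends on the chosen preimage, all others being
  periodic functions of \<open>b * x\<close>; so each averaging step removes one factor at the cost of its
  bound \<open>C m\<close>.\<close>

lemma integral_prod_dilates_le:
  fixes f :: "nat \<Rightarrow> real \<Rightarrow> real"
  assumes b: "b \<ge> 1"
    and "\<And>m. continuous_on UNIV (f m)" "\<And>m x. 0 \<le> f m x" "\<And>m x. f m (x + 1) = f m x"
    and "\<And>m x. (\<Sum>l<b. f m ((x + real l) / real b)) / real b \<le> C m"
  shows "integral {0..1} (\<lambda>x. \<Prod>m<N. f m (real b ^ m * x)) \<le> (\<Prod>m<N. C m)"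
  using assms(2-)
proof (induction N arbitrary: f C)
  case (Suc N)
  note cont = Suc.prems(1) and nonneg = Suc.prems(2) and per = Suc.prems(3) and avg = Suc.prems(4)
  define H where "H x = (\<Prod>m<N. f (Suc m) (real b ^ m * x))" for x
  have cH: "continuous_on A H" for A
    unfolding H_def by (intro continuous_on_prod continuous_on_compose2[OF cont] continuous_intros) auto
  have H0: "0 \<le> H x" for x unfolding H_def by (intro prod_nonneg) (simp add: nonneg)
  have Hper: "H (x + real l) = H x" for x l
  proof -
    have "f (Suc m) (real b ^ m * (x + real l)) = f (Suc m) (real b ^ m * x)" for m
      using periodic_add_nat[of "f (Suc m)" "real b ^ m * x" "b ^ m * l", OF per]
      by (simp add: distrib_left)
    then show ?thesis by (simp add: H_def)
  qed
  have C0: "0 \<le> C m" for m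
    using avg[of m 0] nonneg[of m] by (meson divide_nonneg_nonneg of_nat_0_le_iff order_trans sum_nonneg)
  define A where "A x = (\<Sum>l<b. f 0 ((x + real l) / real b)) / real b" for x
  have cA: "continuous_on S A" for S
    unfolding A_def by (intro continuous_intros continuous_on_compose2[OF cont]) (use b in auto)
  have split: "(\<Prod>m<Suc N. f m (real b ^ m * x)) = f 0 x * H (real b * x)" for x
    unfolding prod.lessThan_Suc_shift H_def by (simp add: mult_ac)
  have "continuous_on UNIV (\<lambda>x. f 0 x * H (real b * x))"
    by (intro continuous_on_mult cont continuous_on_compose2[OF cH[of UNIV]] continuous_intros) auto
  from integral_average[OF this b]
  have "integral {0..1} (\<lambda>x. f 0 x * H (real b * x)) = integral {0..1} (\<lambda>x. A x * H x)"
    using b by (simp add: Hper A_def flip: sum_distrib_right)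
  also have "\<dots> \<le> integral {0..1} (\<lambda>x. C 0 * H x)"
    using avg[of 0]
    by (intro integral_le integrable_continuous_real continuous_intros cA cH mult_right_mono H0)
      (simp add: A_def)
  also have "\<dots> = C 0 * integral {0..1} H" by simp
  also have "\<dots> \<le> C 0 * (\<Prod>m<N. C (Suc m))"
    unfolding H_def by (intro mult_left_mono C0 Suc.IH cont nonneg per avg)
  finally show ?case unfolding split by (simp only: prod.lessThan_Suc_shift o_def)
qed simp

section \<open>Products of consecutive pairs\<close>

text \<open>Dropping the last factor, or the first one, only increases a product of numbers in \<open>[0, 1]\<close>;
  the right-hand side is the product of the two truncated products.\<close>

lemma prod_squared_le_prod_consecutive:
  fixes p :: "nat \<Rightarrow> real"
  assumes "\<And>j. 0 \<le> p j" "\<And>j. p j \<le> 1"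
  shows "(\<Prod>j<Suc N. (p j)\<^sup>2) \<le> (\<Prod>j<N. p j * p (Suc j))"
proof -
  have "(\<Prod>j<Suc N. p j) \<le> (\<Prod>j<N. p j)"
    using assms by (simp add: mult_left_le prod_nonneg)
  moreover have "(\<Prod>j<Suc N. p j) \<le> (\<Prod>j<N. p (Suc j))"
    unfolding prod.lessThan_Suc_shift using assms by (simp add: mult_left_le_one_le prod_nonneg)
  ultimately have "(\<Prod>j<Suc N. p j) * (\<Prod>j<Suc N. p j) \<le> (\<Prod>j<N. p j) * (\<Prod>j<N. p (Suc j))"
    using assms by (intro mult_mono prod_nonneg) auto
  then show ?thesis by (simp only: power2_eq_square flip: prod.distrib)
qed

section \<open>The integral and the maximum of T\<close>

definition T_term :: "nat \<Rightarrow> real \<Rightarrow> real \<Rightarrow> real" where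
  "T_term b \<kappa> x = K b (1 / (real b + 1) * dist_int x) powr \<kappa>"

lemma T_eq_average: "T b \<kappa> x = (\<Sum>l<b. T_term b \<kappa> ((x + real l) / real b)) / real b"
  by (simp add: T_def T_term_def)

lemma T_le_max_T: "b \<ge> 1 \<Longrightarrow> T b \<kappa> x \<le> max_T b \<kappa>"
  using T_attains_max by metis

lemma max_T_pos:
  assumes "b \<ge> 1"
  shows "0 < max_T b \<kappa>"
proof -
  have "0 < T_term b \<kappa> ((0 + real l) / real b)" for l
    using K_arg_pos[OF assms, of "(0 + real l) / real b"] by (simp add: T_term_def)
  then have "0 < T b \<kappa> 0"
    unfolding T_eq_average using assms by (intro divide_pos_pos sum_pos) (auto simp: lessThan_empty_iff)
  also have "\<dots> \<le> max_T b \<kappa>" by (rule T_le_max_T[OF assms])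
  finally show ?thesis .
qed

lemma T_term_periodic: "T_term b \<kappa> (x + 1) = T_term b \<kappa> x"
  using dist_int_add_int[of x 1] by (simp add: T_term_def)

lemma continuous_on_T_term:
  assumes "b \<ge> 1"
  shows "continuous_on S (T_term b \<kappa>)"
  unfolding T_term_def
proof (rule continuous_on_powr)
  show "continuous_on S (\<lambda>x. K b (1 / (real b + 1) * dist_int x))"
    by (intro continuous_on_compose2[OF continuous_on_K[OF assms, of UNIV]] continuous_intros
        continuous_on_dist_int) auto
  show "\<forall>x\<in>S. K b (1 / (real b + 1) * dist_int x) \<noteq> 0"
    using K_arg_pos[OF assms] by (metis less_irrefl)
qed auto

text \<open>Digits \<open>m\<close> outside \<open>M\<close> are given the constant factor 1, whose average is 1, so only the digits
  in \<open>M\<close> contribute a factor \<open>max_T b \<kappa>\<close>. The multiplier \<open>q\<close> is harmless since dilating a periodic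
  function by an integer preserves its mean.\<close>

lemma integral_T_term_prod_le:
  assumes b: "b \<ge> 1" and q: "q \<ge> 1" and M: "M \<subseteq> {..<N}"
  shows "integral {0..1} (\<lambda>x. \<Prod>m\<in>M. T_term b \<kappa> (real b ^ m * (real q * x))) \<le> max_T b \<kappa> ^ card M"
proof -
  define f where "f m = (if m \<in> M then T_term b \<kappa> else (\<lambda>_. 1))" for m
  define C where "C m = (if m \<in> M then max_T b \<kappa> else 1)" for m
  have fM: "(\<Prod>m\<in>M. T_term b \<kappa> (real b ^ m * x)) = (\<Prod>m<N. f m (real b ^ m * x))" for x
    using M by (intro prod.mono_neutral_cong_left) (auto simp: f_def)
  have CM: "max_T b \<kappa> ^ card M = (\<Prod>m<N. C m)"
  proof -
    have "(\<Prod>m\<in>M. max_T b \<kappa>) = (\<Prod>m<N. C m)"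
      using M by (intro prod.mono_neutral_cong_left) (auto simp: C_def)
    then show ?thesis by simp
  qed
  have cont: "continuous_on A (f m)" for m A
    using continuous_on_T_term[OF b] by (simp add: f_def)
  have per: "f m (x + 1) = f m x" for m x by (simp add: f_def T_term_periodic)
  have nonneg: "0 \<le> f m x" for m x by (simp add: f_def T_term_def)
  have avg: "(\<Sum>l<b. f m ((x + real l) / real b)) / real b \<le> C m" for m x
    using T_le_max_T[OF b, of \<kappa> x] b by (simp add: f_def C_def T_eq_average)
  define h where "h x = (\<Prod>m<N. f m (real b ^ m * x))" for x
  have "continuous_on UNIV h"
    unfolding h_def by (intro continuous_on_prod continuous_on_compose2[OF cont[of UNIV]] continuous_intros) auto
  moreover have "h (x + 1) = h x" for x
  proof -
    have "f m (real b ^ m * (x + 1)) = f m (real b ^ m * x)" for m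
      using periodic_add_nat[of "f m" "real b ^ m * x" "b ^ m", OF per] by (simp add: distrib_left)
    then show ?thesis by (simp add: h_def)
  qed
  ultimately have "integral {0..1} (\<lambda>x. h (real q * x)) = integral {0..1} h"
    by (rule integral_periodic_dilate[OF _ _ q])
  also have "\<dots> \<le> (\<Prod>m<N. C m)"
    unfolding h_def by (rule integral_prod_dilates_le[OF b cont nonneg per avg])
  finally show ?thesis by (simp add: fM CM h_def)
qed

text \<open>With \<open>y j\<close> the argument of the \<open>j\<close>-th factor, both \<open>b * y j - y (j + 1)\<close> and
  \<open>b * y (j + 1) - y j\<close> lose one of the two powers of \<open>b\<close> that make up \<open>y j\<close>: they are
  \<open>(b\<^sup>2 - 1) * x\<close> times \<open>b ^ (2 * p + 2 - j)\<close> and \<open>b ^ (j + 1)\<close> respectively. Half of the exponent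
  \<open>\<kappa>\<close> of the pair is spent on each of these two relations, whence the exponent \<open>\<kappa> / 2\<close>. As \<open>j\<close>
  runs through its range the powers of \<open>b\<close> that arise are pairwise distinct, which makes the
  factors accessible to averaging digit by digit.\<close>

lemma K_prod_le_T_term_prod:
  fixes b p :: nat and \<kappa> x :: real
  assumes b: "b \<ge> 1" and \<kappa>: "\<kappa> > 0"
  shows "(\<Prod>j<Suc p. \<bar>K b (x * real b ^ (j + 1) + x * real b ^ (2 * Suc p + 1 - j))\<bar> powr (2 * \<kappa>))
    \<le> (\<Prod>m\<in>{1..p} \<union> {p + 3..2 * p + 2}. T_term b (\<kappa> / 2) (real b ^ m * (real (b\<^sup>2 - 1) * x)))"
proof -
  define y where "y j = x * real b ^ (j + 1) + x * real b ^ (2 * Suc p + 1 - j)" for j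
  define k where "k j = \<bar>K b (y j)\<bar>" for j
  define w where "w = real (b\<^sup>2 - 1) * x"
  have w: "w = (real b ^ 2 - 1) * x" using b by (simp add: w_def of_nat_diff)
  have k: "0 \<le> k j" "k j \<le> 1" for j using abs_K_le_1[OF b] by (simp_all add: k_def)
  have step: "k j powr \<kappa> * k (Suc j) powr \<kappa>
      \<le> T_term b (\<kappa> / 2) (real b ^ (2 * p + 2 - j) * w) * T_term b (\<kappa> / 2) (real b ^ (j + 1) * w)"
    if j: "j < p" for j
  proof -
    define e where "e = 2 * p + 1 - j"
    have e: "2 * Suc p + 1 - j = e + 2" "2 * Suc p + 1 - Suc j = e + 1" "2 * p + 2 - j = e + 1"
      using j by (auto simp: e_def)
    have d1: "real b * y j - y (Suc j) = real b ^ (2 * p + 2 - j) * w"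
      unfolding y_def w e by (simp add: algebra_simps power2_eq_square)
    have d2: "real b * y (Suc j) - y j = real b ^ (j + 1) * w"
      unfolding y_def w e by (simp add: algebra_simps power2_eq_square)
    have "(k j * k (Suc j)) powr (\<kappa> / 2) \<le> T_term b (\<kappa> / 2) (real b ^ (2 * p + 2 - j) * w)"
      unfolding T_term_def d1[symmetric]
      using abs_K_mult_le[OF b, of "y j" "y (Suc j)"] \<kappa> by (intro powr_mono2) (simp_all add: k_def)
    moreover have "(k j * k (Suc j)) powr (\<kappa> / 2) \<le> T_term b (\<kappa> / 2) (real b ^ (j + 1) * w)"
      unfolding T_term_def d2[symmetric]
      using abs_K_mult_le[OF b, of "y (Suc j)" "y j"] \<kappa>
      by (intro powr_mono2) (simp_all add: k_def mult.commute)
    ultimately have "(k j * k (Suc j)) powr (\<kappa> / 2) * (k j * k (Suc j)) powr (\<kappa> / 2)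
        \<le> T_term b (\<kappa> / 2) (real b ^ (2 * p + 2 - j) * w) * T_term b (\<kappa> / 2) (real b ^ (j + 1) * w)"
      by (intro mult_mono) (auto simp: T_term_def)
    moreover have "(k j * k (Suc j)) powr (\<kappa> / 2) * (k j * k (Suc j)) powr (\<kappa> / 2)
        = k j powr \<kappa> * k (Suc j) powr \<kappa>"
    proof -
      have "(k j * k (Suc j)) powr (\<kappa> / 2) * (k j * k (Suc j)) powr (\<kappa> / 2) = (k j * k (Suc j)) powr \<kappa>"
        by (simp flip: powr_add)
      then show ?thesis using k by (simp only: powr_mult)
    qed
    ultimately show ?thesis by (simp only:)
  qed
  have "(\<Prod>j<Suc p. k j powr (2 * \<kappa>)) = (\<Prod>j<Suc p. (k j powr \<kappa>)\<^sup>2)"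
    by (simp add: power2_eq_square flip: powr_add)
  also have "\<dots> \<le> (\<Prod>j<p. k j powr \<kappa> * k (Suc j) powr \<kappa>)"
    using k \<kappa> by (intro prod_squared_le_prod_consecutive) (auto simp: powr_le1)
  also have "\<dots> \<le> (\<Prod>j<p. T_term b (\<kappa> / 2) (real b ^ (2 * p + 2 - j) * w) * T_term b (\<kappa> / 2) (real b ^ (j + 1) * w))"
    using step by (intro prod_mono) auto
  also have "\<dots> = (\<Prod>j<p. T_term b (\<kappa> / 2) (real b ^ (2 * p + 2 - j) * w)) * (\<Prod>j<p. T_term b (\<kappa> / 2) (real b ^ (j + 1) * w))"
    by (rule prod.distrib)
  also have "(\<Prod>j<p. T_term b (\<kappa> / 2) (real b ^ (2 * p + 2 - j) * w)) = (\<Prod>m\<in>{p + 3..2 * p + 2}. T_term b (\<kappa> / 2) (real b ^ m * w))"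
    by (rule prod.reindex_bij_witness[of _ "\<lambda>m. 2 * p + 2 - m" "\<lambda>j. 2 * p + 2 - j"]) auto
  also have "(\<Prod>j<p. T_term b (\<kappa> / 2) (real b ^ (j + 1) * w)) = (\<Prod>m\<in>{1..p}. T_term b (\<kappa> / 2) (real b ^ m * w))"
    by (rule prod.reindex_bij_witness[of _ "\<lambda>m. m - 1" "\<lambda>j. j + 1"]) auto
  also have "(\<Prod>m\<in>{p + 3..2 * p + 2}. T_term b (\<kappa> / 2) (real b ^ m * w)) * (\<Prod>m\<in>{1..p}. T_term b (\<kappa> / 2) (real b ^ m * w))
    = (\<Prod>m\<in>{1..p} \<union> {p + 3..2 * p + 2}. T_term b (\<kappa> / 2) (real b ^ m * w))"
    by (subst prod.union_disjoint) (auto simp: mult.commute)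
  finally show ?thesis by (simp only: k_def y_def w_def)
qed

lemma integral_K_prod_le:
  fixes b n :: nat and \<kappa> :: real
  assumes "b \<ge> 2" and "n \<ge> 1" and "\<kappa> > 0"
  shows "integral {0..1} (\<lambda>\<alpha>::real. \<Prod>j<n.
             \<bar>K b (\<alpha> * real b ^ (j + 1) + \<alpha> * real b ^ (2 * n + 1 - j))\<bar> powr (2 * \<kappa>))
           \<le> max_T b (\<kappa> / 2) ^ (2 * n - 2)"
proof -
  obtain p where n: "n = Suc p" using assms by (cases n) auto
  have b: "b \<ge> 1" using assms by simp
  define M where "M = {1..p} \<union> {p + 3..2 * p + 2}"
  have M: "M \<subseteq> {..<2 * p + 3}" by (auto simp: M_def)
  have cM: "card M = 2 * n - 2" unfolding M_def n by (subst card_Un_disjoint) auto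
  have "b\<^sup>2 \<ge> 2\<^sup>2" using assms by (intro power_mono) auto
  then have q: "b\<^sup>2 - 1 \<ge> 1" by simp
  have "integral {0..1} (\<lambda>\<alpha>::real. \<Prod>j<n.
             \<bar>K b (\<alpha> * real b ^ (j + 1) + \<alpha> * real b ^ (2 * n + 1 - j))\<bar> powr (2 * \<kappa>))
      \<le> integral {0..1} (\<lambda>x. \<Prod>m\<in>M. T_term b (\<kappa> / 2) (real b ^ m * (real (b\<^sup>2 - 1) * x)))"
  proof (rule integral_le)
    show "(\<lambda>\<alpha>::real. \<Prod>j<n.
             \<bar>K b (\<alpha> * real b ^ (j + 1) + \<alpha> * real b ^ (2 * n + 1 - j))\<bar> powr (2 * \<kappa>)) integrable_on {0..1}"
      by (rule K_prod_integrable[OF b assms(3)])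
    show "(\<lambda>x. \<Prod>m\<in>M. T_term b (\<kappa> / 2) (real b ^ m * (real (b\<^sup>2 - 1) * x))) integrable_on {0..1}"
      by (intro integrable_continuous_real continuous_on_prod continuous_intros
          continuous_on_compose2[OF continuous_on_T_term[OF b, of UNIV]]) auto
  qed (unfold n M_def, rule K_prod_le_T_term_prod[OF b assms(3)])
  also have "\<dots> \<le> max_T b (\<kappa> / 2) ^ card M"
    by (rule integral_T_term_prod_le[OF b q M])
  finally show ?thesis by (simp only: cM)
qed

section \<open>A Gaussian bound for the kernel\<close>

lemma mult_cos_le_sin:
  fixes y :: real
  assumes "0 \<le> y" "y \<le> pi"
  shows "y * cos y \<le> sin y"
proof -
  have "sin 0 - 0 * cos 0 \<le> sin y - y * cos y"
  proof (rule DERIV_nonneg_imp_nondecreasing[OF assms(1)])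
    fix z assume z: "0 \<le> z" "z \<le> y"
    have "((\<lambda>z. sin z - z * cos z) has_real_derivative z * sin z) (at z)"
      by (auto intro!: derivative_eq_intros)
    moreover have "0 \<le> z * sin z" using z assms by (intro mult_nonneg_nonneg sin_ge_zero) auto
    ultimately show "\<exists>D. ((\<lambda>z. sin z - z * cos z) has_real_derivative D) (at z) \<and> 0 \<le> D" by blast
  qed
  then show ?thesis by simp
qed

text \<open>The difference of the two sides vanishes at 0 and has derivative
  \<open>y / 3 * (sin y - y * cos y)\<close>. The inequality says that the logarithmic
  derivative of \<open>sin y / y * exp (y\<^sup>2 / 6)\<close> is nonpositive.\<close>

lemma mult_cos_le_sin_cubic:
  fixes y :: real
  assumes "0 \<le> y" "y \<le> pi"
  shows "y * cos y \<le> (1 - y\<^sup>2 / 3) * sin y"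
proof -
  have "(1 - 0\<^sup>2 / 3) * sin 0 - 0 * cos 0 \<le> (1 - y\<^sup>2 / 3) * sin y - y * cos y"
  proof (rule DERIV_nonneg_imp_nondecreasing[OF assms(1)])
    fix z assume z: "0 \<le> z" "z \<le> y"
    have "((\<lambda>z. (1 - z\<^sup>2 / 3) * sin z - z * cos z) has_real_derivative z / 3 * (sin z - z * cos z)) (at z)"
      by (auto intro!: derivative_eq_intros simp: field_simps power2_eq_square)
    moreover have "0 \<le> z / 3 * (sin z - z * cos z)"
      using z assms mult_cos_le_sin[of z] by (intro mult_nonneg_nonneg) auto
    ultimately show "\<exists>D. ((\<lambda>z. (1 - z\<^sup>2 / 3) * sin z - z * cos z) has_real_derivative D) (at z) \<and> 0 \<le> D"
      by blast
  qed
  then show ?thesis by simp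
qed

lemma sinc_gaussian_antimono:
  fixes u v :: real
  assumes "0 < u" "u \<le> v" "v \<le> pi"
  shows "sin v / v * exp (v\<^sup>2 / 6) \<le> sin u / u * exp (u\<^sup>2 / 6)"
proof (rule DERIV_nonpos_imp_nonincreasing[OF assms(2)])
  fix z assume z: "u \<le> z" "z \<le> v"
  then have z0: "0 < z" using assms by simp
  have "((\<lambda>z. sin z / z * exp (z\<^sup>2 / 6)) has_real_derivative
      (z * cos z - (1 - z\<^sup>2 / 3) * sin z) * (exp (z\<^sup>2 / 6) / z\<^sup>2)) (at z)"
    using z0 by (auto intro!: derivative_eq_intros simp: field_simps power2_eq_square)
  moreover have "(z * cos z - (1 - z\<^sup>2 / 3) * sin z) * (exp (z\<^sup>2 / 6) / z\<^sup>2) \<le> 0"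
    using mult_cos_le_sin_cubic[of z] z z0 assms by (intro mult_nonpos_nonneg) auto
  ultimately show "\<exists>D. ((\<lambda>z. sin z / z * exp (z\<^sup>2 / 6)) has_real_derivative D) (at z) \<and> D \<le> 0" by blast
qed

text \<open>With \<open>y = pi * t\<close>, the value \<open>K b t\<close> is the ratio of \<open>sin v / v\<close> at \<open>v = b * y\<close> and at
  \<open>v = y\<close>; monotonicity of \<open>sin v / v * exp (v\<^sup>2 / 6)\<close> compares the two. The quadratic coefficient
  is that of the Taylor expansion of \<open>ln (K b t)\<close> at 0, so the exponent is best possible.\<close>

lemma K_le_gaussian:
  assumes b: "b \<ge> 1" and t: "0 \<le> t" "t \<le> 1 / (2 * real b)"
  shows "K b t \<le> exp (- (pi\<^sup>2 * ((real b)\<^sup>2 - 1) / 6 * t\<^sup>2))"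
proof (cases "t = 0")
  case True
  then show ?thesis by (simp add: K_def)
next
  case False
  define y where "y = pi * t"
  have y0: "0 < y" using False t by (simp add: y_def)
  have "real b * t \<le> 1 / 2" using t b by (simp add: field_simps)
  then have "pi * (real b * t) \<le> pi * (1 / 2)" by (intro mult_left_mono) auto
  then have by2: "real b * y \<le> pi / 2" by (simp add: y_def mult_ac)
  have yb: "y \<le> real b * y" using b y0 by simp
  have s: "0 < sin y" using y0 yb by2 pi_gt_zero by (intro sin_gt_zero) linarith+
  have "1 / (2 * real b) \<le> 1 / 2" using b by (simp add: field_simps)
  then have "t \<notin> \<int>" using t False by (auto elim!: Ints_cases)
  then have Kt: "K b t = sin (real b * y) / (real b * sin y)"
    by (simp add: K_def y_def mult_ac)
  have "sin (real b * y) / (real b * y) * exp ((real b * y)\<^sup>2 / 6) \<le> sin y / y * exp (y\<^sup>2 / 6)"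
    using y0 yb by2 pi_gt_zero by (intro sinc_gaussian_antimono) linarith+
  then have "sin (real b * y) / (real b * sin y) \<le> exp (y\<^sup>2 / 6) / exp ((real b * y)\<^sup>2 / 6)"
    using y0 s b by (simp add: field_simps)
  also have "\<dots> = exp (y\<^sup>2 / 6 - (real b * y)\<^sup>2 / 6)" by (simp add: exp_diff)
  also have "y\<^sup>2 / 6 - (real b * y)\<^sup>2 / 6 = - (pi\<^sup>2 * ((real b)\<^sup>2 - 1) / 6 * t\<^sup>2)"
    by (simp add: y_def field_simps)
  finally show ?thesis by (simp only: Kt)
qed

section \<open>Gaussian sums and the bound for T\<close>

text \<open>Up to the factor \<open>sqrt (pi / c)\<close> the integrand is the normal density of variance
  \<open>1 / (2 * c)\<close>.\<close>

lemma gaussian_integral_Icc_le: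
  fixes c u v :: real
  assumes c: "c > 0"
  shows "integral {u..v} (\<lambda>x. exp (- c * x\<^sup>2)) \<le> sqrt (pi / c)"
proof -
  define \<sigma> where "\<sigma> = sqrt (1 / (2 * c))"
  have s2: "\<sigma>\<^sup>2 = 1 / (2 * c)" using c by (simp add: \<sigma>_def)
  have nd: "exp (- c * x\<^sup>2) = sqrt (pi / c) * normal_density 0 \<sigma> x" for x
    using c by (simp add: normal_density_def s2 real_sqrt_divide)
  have \<sigma>: "0 < \<sigma>" using c by (simp add: \<sigma>_def)
  have I: "(normal_density 0 \<sigma> has_integral 1) UNIV"
    using has_integral_integral_lborel[OF integrable_normal_density[OF \<sigma>, of 0]] integral_normal_density[OF \<sigma>, of 0] by simp
  have "integral {u..v} (normal_density 0 \<sigma>) \<le> integral UNIV (normal_density 0 \<sigma>)"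
    using I by (intro integral_subset_le integrable_on_subinterval[of _ UNIV]) (auto simp: integrable_on_def)
  also have "\<dots> = 1" using I by (rule integral_unique)
  finally have "sqrt (pi / c) * integral {u..v} (normal_density 0 \<sigma>) \<le> sqrt (pi / c) * 1"
    using c by (intro mult_left_mono) auto
  then show ?thesis unfolding nd by simp
qed

text \<open>Integral comparison for a unimodal function: the term nearest to the peak is at most 1, and any
  other term is at most the integral over the unit interval that joins its point to the next one
  in the direction of the peak.\<close>

lemma gaussian_sum_le:
  fixes c a :: real and S :: "int set"
  assumes c: "c > 0" and S: "finite S"
  shows "(\<Sum>k\<in>S. exp (- c * (a + of_int k)\<^sup>2)) \<le> 1 + sqrt (pi / c)"
proof -
  define f where "f x = exp (- c * x\<^sup>2)" for x :: real
  \<comment> \<open>Shifting the index moves the centre to \<open>\<bar>r\<bar> \<le> 1 / 2\<close>, so that the term of index 0 is the one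
    nearest to the peak and the unit steps towards it never overshoot.\<close>
  define r where "r = a - of_int (round a)"
  have r: "\<bar>r\<bar> \<le> 1 / 2" using of_int_round_abs_le[of a] by (simp add: r_def abs_minus_commute)
  have fi: "f integrable_on {u..v}" for u v
    unfolding f_def by (intro integrable_continuous_real continuous_intros)
  have f0: "0 \<le> f x" for x by (simp add: f_def)
  have low: "f z \<le> integral {u..u + 1} f" if "\<And>x. x \<in> {u..u + 1} \<Longrightarrow> \<bar>x\<bar> \<le> \<bar>z\<bar>" for u z
  proof -
    have "f z \<le> f x" if "x \<in> {u..u + 1}" for x
      using \<open>x \<in> {u..u + 1} \<Longrightarrow> \<bar>x\<bar> \<le> \<bar>z\<bar>\<close>[OF that] c by (simp add: f_def abs_le_square_iff)
    then have "integral {u..u + 1} (\<lambda>_. f z) \<le> integral {u..u + 1} f"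
      by (intro integral_le fi) auto
    then show ?thesis by simp
  qed
  have sym: "(\<Sum>k\<in>{- int N..int N}. f (r + of_int k)) \<le> 1 + integral {r - real N..r + real N} f" for N
  proof (induction N)
    case 0
    then show ?case using c by (simp add: f_def)
  next
    case (Suc N)
    have "{- int (Suc N)..int (Suc N)} = insert (- int (Suc N)) (insert (int (Suc N)) {- int N..int N})"
      by auto
    then have "(\<Sum>k\<in>{- int (Suc N)..int (Suc N)}. f (r + of_int k))
        = f (r - real N - 1) + (f (r + real N + 1) + (\<Sum>k\<in>{- int N..int N}. f (r + of_int k)))"
      by (simp add: algebra_simps)
    also have "\<dots> \<le> integral {r - real N - 1..r - real N} f + (integral {r + real N..r + real N + 1} f
        + (1 + integral {r - real N..r + real N} f))"
    proof (intro add_mono Suc.IH)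
      show "f (r - real N - 1) \<le> integral {r - real N - 1..r - real N} f"
        using low[of "r - real N - 1" "r - real N - 1"] r
        by (simp add: abs_le_iff) (smt (verit) of_nat_0_le_iff)
      show "f (r + real N + 1) \<le> integral {r + real N..r + real N + 1} f"
        using low[of "r + real N" "r + real N + 1"] r
        by (simp add: abs_le_iff) (smt (verit) of_nat_0_le_iff)
    qed
    also have "\<dots> = 1 + (integral {r - real N - 1..r - real N} f
        + integral {r - real N..r + real N} f + integral {r + real N..r + real N + 1} f)"
      by simp
    also have "integral {r - real N - 1..r - real N} f + integral {r - real N..r + real N} f
        = integral {r - real N - 1..r + real N} f"
      by (intro Henstock_Kurzweil_Integration.integral_combine fi) auto
    also have "\<dots> + integral {r + real N..r + real N + 1} f = integral {r - real N - 1..r + real N + 1} f"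
      by (intro Henstock_Kurzweil_Integration.integral_combine fi) auto
    finally show ?case by (simp add: algebra_simps)
  qed
  define S' where "S' = (\<lambda>k. k + round a) ` S"
  have S': "finite S'" using S by (simp add: S'_def)
  define N where "N = nat (Max (insert 0 (abs ` S')))"
  have "\<bar>k\<bar> \<le> int N" if "k \<in> S'" for k
  proof -
    have "\<bar>k\<bar> \<le> Max (insert 0 (abs ` S'))" using S' that by (intro Max_ge) auto
    then show ?thesis unfolding N_def by linarith
  qed
  then have sub: "S' \<subseteq> {- int N..int N}" by (fastforce simp: abs_le_iff)
  have "(\<Sum>k\<in>S. f (a + of_int k)) = (\<Sum>k\<in>S'. f (r + of_int k))"
    unfolding S'_def by (subst sum.reindex) (auto simp: inj_on_def r_def algebra_simps)
  also have "\<dots> \<le> (\<Sum>k\<in>{- int N..int N}. f (r + of_int k))"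
    using sub f0 by (intro sum_mono2) auto
  also have "\<dots> \<le> 1 + integral {r - real N..r + real N} f" by (rule sym)
  also have "\<dots> \<le> 1 + sqrt (pi / c)"
    unfolding f_def using gaussian_integral_Icc_le[OF c] by simp
  finally show ?thesis by (simp add: f_def)
qed

lemma T_term_le_gaussian:
  assumes b: "b \<ge> 1" and \<kappa>: "\<kappa> > 0"
  shows "T_term b \<kappa> x \<le> exp (- (pi\<^sup>2 * (real b - 1) * \<kappa> / (6 * (real b + 1))) * (dist_int x)\<^sup>2)"
proof -
  define t where "t = 1 / (real b + 1) * dist_int x"
  have t0: "0 \<le> t" and t1: "t \<le> 1 / (2 * real b)"
    unfolding t_def by (rule scaled_dist_int_bounds[OF b])+
  have "K b t powr \<kappa> \<le> exp (- (pi\<^sup>2 * ((real b)\<^sup>2 - 1) / 6 * t\<^sup>2)) powr \<kappa>"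
    using K_le_gaussian[OF b t0 t1] K_arg_pos[OF b, of x] \<kappa> by (intro powr_mono2) (auto simp: t_def)
  also have "\<dots> = exp (- (pi\<^sup>2 * (real b - 1) * \<kappa> / (6 * (real b + 1))) * (dist_int x)\<^sup>2)"
  proof -
    have "(real b)\<^sup>2 - 1 = (real b - 1) * (real b + 1)" by (simp add: algebra_simps power2_eq_square)
    then have "((real b)\<^sup>2 - 1) * t\<^sup>2 = (real b - 1) / (real b + 1) * (dist_int x)\<^sup>2"
      using b by (simp add: t_def power2_eq_square divide_simps)
    then show ?thesis by (simp add: powr_def mult_ac) 
  qed
  finally show ?thesis by (simp add: T_term_def t_def)
qed

text \<open>The points \<open>(\<alpha> + l) / b\<close>, each reduced to its representative of least absolute value modulo 1,
  are distinct points of the lattice \<open>(\<alpha> + \<int>) / b\<close>, so the average is a Riemann sum of a Gaussian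
  with mesh \<open>1 / b\<close>.\<close>

lemma T_le:
  assumes b: "b \<ge> 2" and \<kappa>: "\<kappa> > 0"
  shows "T b \<kappa> \<alpha> \<le> 1 / real b + sqrt (6 * (real b + 1) / (pi * (real b - 1) * \<kappa>))"
proof -
  define a where "a = pi\<^sup>2 * (real b - 1) * \<kappa> / (6 * (real b + 1))"
  define c where "c = a / (real b)\<^sup>2"
  \<comment> \<open>The representative of \<open>(\<alpha> + l) / b\<close> nearest to 0 modulo 1 is \<open>(\<alpha> + i l) / b\<close>; the map \<open>i\<close> is
    injective since it does not change \<open>l\<close> modulo \<open>b\<close>.\<close>
  define i where "i l = int l - int b * round ((\<alpha> + real l) / real b)" for l
  have a0: "a > 0" using b \<kappa> by (simp add: a_def)
  then have c0: "c > 0" using b by (simp add: c_def)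
  have inj: "inj_on i {..<b}"
  proof (rule inj_onI)
    fix l m assume lm: "l \<in> {..<b}" "m \<in> {..<b}" "i l = i m"
    have "i k mod int b = int k" if "k < b" for k
      using that by (simp add: i_def mod_diff_eq[symmetric])
    then show "l = m" using lm by (metis lessThan_iff of_nat_eq_iff)
  qed
  have "T b \<kappa> \<alpha> = (\<Sum>l<b. T_term b \<kappa> ((\<alpha> + real l) / real b)) / real b" by (rule T_eq_average)
  also have "\<dots> \<le> (\<Sum>l<b. exp (- c * (\<alpha> + of_int (i l))\<^sup>2)) / real b"
  proof (intro divide_right_mono sum_mono)
    fix l
    have "dist_int ((\<alpha> + real l) / real b) = \<bar>(\<alpha> + of_int (i l)) / real b\<bar>"
      using b by (simp add: dist_int_attained i_def field_simps)
    then have "a * (dist_int ((\<alpha> + real l) / real b))\<^sup>2 = c * (\<alpha> + of_int (i l))\<^sup>2"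
      by (simp add: c_def power_divide)
    then show "T_term b \<kappa> ((\<alpha> + real l) / real b) \<le> exp (- c * (\<alpha> + of_int (i l))\<^sup>2)"
      using T_term_le_gaussian[of b \<kappa> "(\<alpha> + real l) / real b"] b \<kappa> by (simp add: a_def)
  qed simp
  also have "(\<Sum>l<b. exp (- c * (\<alpha> + of_int (i l))\<^sup>2)) = (\<Sum>k\<in>i ` {..<b}. exp (- c * (\<alpha> + of_int k)\<^sup>2))"
    using inj by (simp add: sum.reindex)
  also have "\<dots> / real b \<le> (1 + sqrt (pi / c)) / real b"
    by (intro divide_right_mono gaussian_sum_le c0) auto
  also have "\<dots> = 1 / real b + sqrt (pi / a)"
    using b by (simp add: c_def real_sqrt_divide real_sqrt_mult field_simps)
  also have "pi / a = 6 * (real b + 1) / (pi * (real b - 1) * \<kappa>)"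
    using b by (simp add: a_def power2_eq_square)
  finally show ?thesis .
qed

theorem proposition7p1:
  fixes b n :: nat and \<kappa> :: real
  assumes "b \<ge> 2" and "n \<ge> 1" and "\<kappa> > 0"
  shows "integral {0..1} (\<lambda>\<alpha>::real. \<Prod>j<n.
             \<bar>K b (\<alpha> * real b ^ (j + 1) + \<alpha> * real b ^ (2 * n + 1 - j))\<bar> powr (2 * \<kappa>))
           \<le> max_T b (\<kappa> / 2) ^ (2 * n - 2)
       \<and> max_T b (\<kappa> / 2) ^ (2 * n - 2)
           = real b powr (- zeta b (\<kappa> / 2) * (2 * real n - 2))
       \<and> real b powr (- zeta b (\<kappa> / 2) * (2 * real n - 2))
           \<le> (1 / real b + sqrt (12 * (real b + 1) / (pi * (real b - 1) * \<kappa>))) ^ (2 * n - 2)"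
proof -
  have b: "b \<ge> 1" using assms by simp
  have pos: "0 < max_T b (\<kappa> / 2)" by (rule max_T_pos[OF b])
  have "real b powr (- zeta b (\<kappa> / 2)) = max_T b (\<kappa> / 2)"
    using pos assms(1) by (simp add: zeta_def powr_def)
  then have "real b powr (- zeta b (\<kappa> / 2) * real (2 * n - 2)) = max_T b (\<kappa> / 2) ^ (2 * n - 2)"
    using powr_realpow[OF pos, of "2 * n - 2"] by (simp only: powr_powr[symmetric])
  moreover have "real (2 * n - 2) = 2 * real n - 2" using assms(2) by (simp add: of_nat_diff)
  ultimately have eq: "max_T b (\<kappa> / 2) ^ (2 * n - 2) = real b powr (- zeta b (\<kappa> / 2) * (2 * real n - 2))"
    by (simp only:)
  have "max_T b (\<kappa> / 2) \<le> 1 / real b + sqrt (12 * (real b + 1) / (pi * (real b - 1) * \<kappa>))"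
  proof -
    obtain \<alpha> where "T b (\<kappa> / 2) \<alpha> = max_T b (\<kappa> / 2)" using T_attains_max[OF b] by metis
    moreover have "6 * (real b + 1) / (pi * (real b - 1) * (\<kappa> / 2))
        = 12 * (real b + 1) / (pi * (real b - 1) * \<kappa>)"
      by simp
    ultimately show ?thesis
      using T_le[of b "\<kappa> / 2" \<alpha>] assms by (simp only: half_gt_zero_iff)
  qed
  then have "max_T b (\<kappa> / 2) ^ (2 * n - 2)
      \<le> (1 / real b + sqrt (12 * (real b + 1) / (pi * (real b - 1) * \<kappa>))) ^ (2 * n - 2)"
    using pos by (intro power_mono) auto
  with integral_K_prod_le[OF assms] eq show ?thesis by (simp only: simp_thms)
qed

end
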